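(* Let $0<R_1<R$, $\omega>0$, $T_0>0$ and $T>R+R_1+T_0$. Let $x^{(1)},x^{(2)},x^{(3)},x^{(4)}\in\Gamma_R=\{x\in\mathbb R^3:|x|=R\}$ be four receivers which do not lie on one plane. Consider orbit functions $a:[0,+\infty)\to\mathbb R^3$ with $a\in\mathcal C^2(0,+\infty)$, $a(0)=0$, $|a'(t)|<1$ and $|a(t)|<R_1$ for all $t>0$, and let $u=u_a$ be the solution of $$\begin{cases}\partial_t^2u(x,t)-\Delta u(x,t)=\delta(x-a(t))\cos(\omega t), & (x,t)\in\mathbb R^3\times\mathbb R^+,\\ u(x,0)=\partial_tu(x,0)=0, & x\in\mathbb R^3.\end{cases}$$ Then $\{a(t):t\in(0,T_0)\}$ is uniquely determined by the data $\{u(x^{(j)},t):j=1,\dots,4,\ t\in(0,T)\}$. That is, if $a_1,a_2$ are two such orbit functions and $u_{a_1}(x^{(j)},t)=u_{a_2}(x^{(j)},t)$ for $j=1,2,3,4$ and $t\in(0,T)$, then $a_1(t)=a_2(t)$ for all $t\in(0,T_0)$.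
   Context: $\delta$ is the Dirac delta distribution in space. Orbit functions are continuous on $[0,+\infty)$. The solution $u$ is the causal solution expressed through the Green's function of the wave equation in $\mathbb R^3$, i.e. $$u(x,t)=\int_0^\infty\frac{\delta(t-s-|x-a(s)|)}{4\pi|x-a(s)|}\cos(\omega s)\,\mathrm ds ,$$ where $\delta$ in this formula is the one-dimensional Dirac delta. *)

theory Defs
  imports "HOL-Analysis.Analysis"
begin

text \<open>Meant for open \<open>S\<close>.\<close>

definition C2_on :: "(real \<Rightarrow> 'a::real_normed_vector) \<Rightarrow> real set \<Rightarrow> bool" where
  "C2_on f S \<longleftrightarrow> (\<exists>f' f''. (\<forall>t\<in>S. (f has_vector_derivative f' t) (at t)
      \<and> (f' has_vector_derivative f'' t) (at t)) \<and> continuous_on S f'')"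

text \<open>Continuity up to \<open>0\<close> but \<open>C\<^sup>2\<close> only on the open half-line: no one-sided derivatives at \<open>0\<close>
  are required, and the values of \<open>a\<close> at negative times are irrelevant.\<close>

definition orbit_function :: "real \<Rightarrow> (real \<Rightarrow> real ^ 3) \<Rightarrow> bool" where
  "orbit_function R\<^sub>1 a \<longleftrightarrow> continuous_on {0..} a \<and> C2_on a {0<..} \<and> a 0 = 0
     \<and> (\<forall>t>0. norm (vector_derivative a (at t)) < 1) \<and> (\<forall>t>0. norm (a t) < R\<^sub>1)"

text \<open>Test functions on an open set of times, i.e. \<open>C\<^sub>c\<^sup>\<infinity>(\<Omega>)\<close>.\<close>

definition test_function :: "real set \<Rightarrow> (real \<Rightarrow> real) \<Rightarrow> bool" where
  "test_function \<Omega> \<phi> \<longleftrightarrow> (\<forall>n t. (deriv ^^ n) \<phi> differentiable (at t))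
     \<and> compact (closure {t. \<phi> t \<noteq> 0}) \<and> closure {t. \<phi> t \<noteq> 0} \<subseteq> \<Omega>"

text \<open>The distribution \<open>\<delta>(t - c)\<close> in the variable \<open>t\<close>.\<close>

definition dirac :: "real \<Rightarrow> (real \<Rightarrow> real) \<Rightarrow> real" where
  "dirac c \<phi> = \<phi> c"

text \<open>The causal solution of the wave equation with source \<open>\<delta>(x - a(t)) cos(\<omega>t)\<close> and zero initial
  data, given by the retarded Green's function of the wave equation:
  \[ u(x,t) = \int_0^\infty \frac{\delta(t - s - |x - a(s)|)}{4\pi|x - a(s)|}\cos(\omega s)\,ds. \]
  For fixed \<open>x\<close> off the orbit this is a superposition over \<open>s\<close> of Dirac distributions in \<open>t\<close>, hence a
  distribution in \<open>t\<close>; \<open>wave_field \<omega> a x \<phi>\<close> is the pairing of \<open>u(x, \<cdot>)\<close> with the test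
  function \<open>\<phi>\<close>. If \<open>x\<close> has positive distance to the orbit, the integrand is bounded and vanishes
  for large \<open>s\<close>, so the integral exists.\<close>

definition wave_field :: "real \<Rightarrow> (real \<Rightarrow> real ^ 3) \<Rightarrow> real ^ 3 \<Rightarrow> (real \<Rightarrow> real) \<Rightarrow> real" where
  "wave_field \<omega> a x \<phi> =
     (LBINT s:{0..}. dirac (s + norm (x - a s)) \<phi> / (4 * pi * norm (x - a s)) * cos (\<omega> * s))"

text \<open>Equality on the open set \<open>\<Omega>\<close> of two distributions in \<open>t\<close>. For distributions given by locally
  integrable functions this is equality almost everywhere on \<open>\<Omega>\<close>.\<close>

definition distr_eq_on :: "real set \<Rightarrow> ((real \<Rightarrow> real) \<Rightarrow> real) \<Rightarrow> ((real \<Rightarrow> real) \<Rightarrow> real) \<Rightarrow> bool" where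
  "distr_eq_on \<Omega> U V \<longleftrightarrow> (\<forall>\<phi>. test_function \<Omega> \<phi> \<longrightarrow> U \<phi> = V \<phi>)"

end

theory Submission
  imports Defs
begin

text \<open>
  Fix a receiver \<open>y\<close> on the sphere. A signal emitted at time \<open>s\<close> arrives at \<open>y\<close> at time
  \<open>h(s) = s + |y - a(s)|\<close>, and \<open>h\<close> is strictly increasing because the source moves slower than the
  waves. The field at \<open>y\<close> is the image under \<open>h\<close> of the signed measure
  \<open>cos(\<omega>s) / (4\<pi>(h(s) - s)) ds\<close>. Testing it against smooth approximations of the indicator of
  \<open>(R/2, B)\<close> shows that the data determine, for every \<open>B < T\<close>, the integral of
  \<open>cos(\<omega>s) / (h(s) - s)\<close> over the emission times whose signal has arrived before \<open>B\<close>
  (\<open>wave_field_bump_tendsto\<close>, \<open>emission_integral_eq\<close>).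

  For two orbits with the same data, let \<open>h\<^sub>1\<close>, \<open>h\<^sub>2\<close> be the arrival times and \<open>\<theta> = h\<^sub>2\<^sup>-\<^sup>1 \<circ> h\<^sub>1\<close>, so that the
  signals emitted at \<open>s\<close> along the first orbit and at \<open>\<theta>(s)\<close> along the second arrive together.
  Differentiating the equality of integrals gives
  \<open>cos(\<omega>\<theta>) \<theta>' / (h\<^sub>1(s) - \<theta>) = cos(\<omega>s) / (h\<^sub>1(s) - s)\<close>, and therefore
  \[ \frac{d}{ds} \bigl(\sin \omega s - \sin \omega\theta(s)\bigr)
       = - \frac{\omega \cos(\omega s)\,(s - \theta(s))}{h_1(s) - s}. \]
  This is a differential equation for \<open>\<theta>\<close> with \<open>\<theta>(0) = 0\<close>, degenerate where the source amplitude
  \<open>cos(\<omega>s)\<close> vanishes, so that standard uniqueness theorems do not apply there. The sign on the right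
  decides instead: suppose \<open>\<theta>(s) < s\<close> just after a point \<open>\<alpha>\<close> with \<open>\<theta>(\<alpha>) = \<alpha>\<close>. The cosine has a constant
  sign just after \<open>\<alpha>\<close>. If it is positive, \<open>sin \<omega>s - sin \<omega>\<theta>(s)\<close> starts at \<open>0\<close> and decreases, although
  the sine increases there and \<open>\<theta>(s) < s\<close>; if it is negative, all signs are reversed. Either way this
  is a contradiction (\<open>delay_comparison\<close>). By the symmetry of the two orbits, \<open>h\<^sub>1 = h\<^sub>2\<close> as long as the
  arrival time stays below \<open>T\<close>, which covers all emission times in \<open>(0, T\<^sub>0)\<close>.

  Hence at each such time both orbits have the same distance to each receiver, and the points at equal
  distance from two distinct points form a plane, which does not contain all four receivers
  (\<open>dist_eq_on_noncoplanar\<close>).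
\<close>

section \<open>Smooth approximations of indicator functions\<close>

text \<open>For \<open>p = 1\<close> this is the classical function \<open>exp(-1/x)\<close> extended by \<open>0\<close>. Admitting polynomial
  factors in \<open>1/x\<close> makes the family closed under differentiation, which turns smoothness into a
  single derivative computation.\<close>

definition flat :: "real poly \<Rightarrow> real \<Rightarrow> real" where
  "flat p x = (if x > 0 then poly p (1 / x) * exp (- (1 / x)) else 0)"

lemma tendsto_poly_times_exp_at_top:
  fixes p :: "real poly"
  shows "((\<lambda>y. poly p y * exp (- y)) \<longlongrightarrow> 0) at_top"
proof -
  have "((\<lambda>y. \<Sum>i\<le>degree p. coeff p i * (y ^ i / exp y)) \<longlongrightarrow> (\<Sum>i\<le>degree p. coeff p i * 0)) at_top"
    by (intro tendsto_intros tendsto_power_div_exp_0)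
  then show ?thesis
    by (simp add: poly_altdef exp_minus sum_distrib_left sum_distrib_right divide_inverse mult_ac)
qed

lemma flat_smult: "flat (smult c p) x = c * flat p x"
  by (simp add: flat_def)

text \<open>In the variable \<open>y = 1/x\<close> the derivative \<open>d/dx\<close> is \<open>-y\<^sup>2 d/dy\<close>, and it maps \<open>p(y) exp(-y)\<close> to
  \<open>y\<^sup>2 (p(y) - p'(y)) exp(-y)\<close>; this is where the polynomial \<open>y\<^sup>2 (p - p')\<close> comes from. At \<open>0\<close> the
  exponential beats every power of \<open>y\<close>.\<close>

lemma has_derivative_flat:
  "(flat p has_real_derivative flat ([:0, 0, 1:] * (p - pderiv p)) x) (at x)"
proof (cases x "0 :: real" rule: linorder_cases)
  case greater
  have "((\<lambda>x. poly p (1 / x) * exp (- (1 / x))) has_real_derivative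
          flat ([:0, 0, 1:] * (p - pderiv p)) x) (at x)"
    using greater
    by (auto intro!: derivative_eq_intros poly_DERIV[THEN DERIV_chain2]
        simp: flat_def field_simps power2_eq_square)
  then show ?thesis
    by (rule has_field_derivative_transform_within_open[where S = "{0<..}"])
      (use greater in \<open>auto simp: flat_def\<close>)
next
  case less
  have "((\<lambda>x. 0) has_real_derivative flat ([:0, 0, 1:] * (p - pderiv p)) x) (at x)"
    using less by (auto simp: flat_def)
  then show ?thesis
    by (rule has_field_derivative_transform_within_open[where S = "{..<0}"])
      (use less in \<open>auto simp: flat_def\<close>)
next
  case equal
  have "((\<lambda>h. flat p h / h) \<longlongrightarrow> 0) (at_left 0)"
    by (rule tendsto_eventually) (auto simp: flat_def eventually_at_filter)
  moreover have "((\<lambda>h. flat p h / h) \<longlongrightarrow> 0) (at_right 0)"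
  proof -
    \<comment> \<open>Dividing by \<open>h\<close> multiplies the polynomial in \<open>1/h\<close> by its variable.\<close>
    have "((\<lambda>h. poly (pCons 0 p) (inverse h) * exp (- inverse h)) \<longlongrightarrow> 0) (at_right (0 :: real))"
      by (rule filterlim_compose[OF tendsto_poly_times_exp_at_top filterlim_inverse_at_top_right])
    then show ?thesis
      by (rule Lim_transform_eventually)
        (auto simp: flat_def eventually_at_filter field_simps)
  qed
  ultimately have "((\<lambda>h. flat p h / h) \<longlongrightarrow> 0) (at 0)"
    by (simp add: filterlim_at_split)
  then show ?thesis
    using equal by (simp add: DERIV_def flat_def)
qed

lemma has_derivative_flat_affine:
  assumes "(g has_real_derivative c) (at x)"
  shows "((\<lambda>x. flat p (g x)) has_real_derivative
           flat (smult c ([:0, 0, 1:] * (p - pderiv p))) (g x)) (at x)"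
  using DERIV_chain2[OF has_derivative_flat assms, of p] by (simp only: flat_smult mult.commute)

text \<open>The product rule leaves the set of products of two such functions, but not the sums of such
  products.\<close>

inductive flat_span :: "real \<Rightarrow> real \<Rightarrow> real \<Rightarrow> (real \<Rightarrow> real) \<Rightarrow> bool" for k A B where
  prod: "flat_span k A B (\<lambda>x. flat p (k * (x - A)) * flat q (k * (B - x)))"
| sum: "flat_span k A B f \<Longrightarrow> flat_span k A B g \<Longrightarrow> flat_span k A B (\<lambda>x. f x + g x)"

lemma flat_span_derivative:
  assumes "flat_span k A B f"
  shows "\<exists>g. flat_span k A B g \<and> (\<forall>x. (f has_real_derivative g x) (at x))"
  using assms
proof induction
  case (prod p q)
  define p' where "p' = smult k ([:0, 0, 1:] * (p - pderiv p))"
  define q' where "q' = smult (- k) ([:0, 0, 1:] * (q - pderiv q))"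
  have "((\<lambda>x. flat p (k * (x - A))) has_real_derivative flat p' (k * (x - A))) (at x)" for x
    unfolding p'_def by (rule has_derivative_flat_affine) (auto intro!: derivative_eq_intros)
  moreover have "((\<lambda>x. flat q (k * (B - x))) has_real_derivative flat q' (k * (B - x))) (at x)" for x
    unfolding q'_def by (rule has_derivative_flat_affine) (auto intro!: derivative_eq_intros)
  ultimately have "((\<lambda>x. flat p (k * (x - A)) * flat q (k * (B - x))) has_real_derivative
      flat p' (k * (x - A)) * flat q (k * (B - x)) + flat p (k * (x - A)) * flat q' (k * (B - x)))
      (at x)" for x
    by (auto intro!: derivative_eq_intros)
  then show ?case
    by (intro exI[of _ "\<lambda>x. flat p' (k * (x - A)) * flat q (k * (B - x))
                          + flat p (k * (x - A)) * flat q' (k * (B - x))"] conjI flat_span.intros) auto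
next
  case (sum f g)
  then obtain f' g' where "flat_span k A B f'" "\<And>x. (f has_real_derivative f' x) (at x)"
    "flat_span k A B g'" "\<And>x. (g has_real_derivative g' x) (at x)"
    by blast
  then show ?case
    by (intro exI[of _ "\<lambda>x. f' x + g' x"]) (auto intro: flat_span.intros derivative_intros)
qed

lemma flat_span_smooth:
  assumes "flat_span k A B f"
  shows "(deriv ^^ n) f differentiable (at t)"
proof -
  have "flat_span k A B ((deriv ^^ n) f)"
  proof (induction n)
    case (Suc n)
    then obtain g where g: "flat_span k A B g"
      and "\<And>x. ((deriv ^^ n) f has_real_derivative g x) (at x)"
      using flat_span_derivative by blast
    then have "deriv ((deriv ^^ n) f) = g"
      by (auto intro: DERIV_imp_deriv)
    with g show ?case by simp
  qed (use assms in simp)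
  then show ?thesis
    using flat_span_derivative real_differentiable_def by blast
qed

text \<open>On \<open>(A, B)\<close> this is \<open>exp(-(1/k) (1/(t - A) + 1/(B - t)))\<close>. As \<open>k\<close> grows it tends to \<open>1\<close> there,
  so that the family approximates the indicator of \<open>(A, B)\<close> with \<open>1\<close> as a common bound.\<close>

definition bump :: "real \<Rightarrow> real \<Rightarrow> real \<Rightarrow> real \<Rightarrow> real" where
  "bump k A B t = flat 1 (k * (t - A)) * flat 1 (k * (B - t))"

lemma bump_range: "0 \<le> bump k A B t" "bump k A B t \<le> 1"
  unfolding bump_def flat_def by (auto intro!: mult_le_one)

lemma bump_eq_0:
  assumes "k > 0" "t \<notin> {A<..<B}"
  shows "bump k A B t = 0"
proof -
  have "k * (t - A) \<le> 0 \<or> k * (B - t) \<le> 0"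
    using assms by (auto simp: mult_le_0_iff)
  then show ?thesis
    by (auto simp: bump_def flat_def)
qed

lemma test_function_bump:
  assumes "k > 0" "{A..B} \<subseteq> \<Omega>"
  shows "test_function \<Omega> (bump k A B)"
proof -
  have "t \<in> {A..B}" if "bump k A B t \<noteq> 0" for t
    using bump_eq_0[OF \<open>k > 0\<close>, of t A B] that by (cases "t \<in> {A<..<B}") auto
  then have "{t. bump k A B t \<noteq> 0} \<subseteq> {A..B}"
    by blast
  then have *: "closure {t. bump k A B t \<noteq> 0} \<subseteq> {A..B}"
    by (simp add: closure_minimal)
  moreover have "compact (closure {t. bump k A B t \<noteq> 0})"
    using * compact_Icc by (metis closed_closure compact_Int_closed inf.absorb_iff2)
  moreover have "(deriv ^^ n) (bump k A B) differentiable (at t)" for n t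
    unfolding bump_def by (rule flat_span_smooth[OF flat_span.prod])
  ultimately show ?thesis
    using assms by (auto simp: test_function_def)
qed

lemma bump_tendsto_indicator:
  "(\<lambda>k. bump (real (Suc k)) A B t) \<longlonglongrightarrow> indicator {A<..<B} t"
proof (cases "t \<in> {A<..<B}")
  case True
  have lim: "(\<lambda>k. flat 1 (real (Suc k) * c)) \<longlonglongrightarrow> 1" if "c > 0" for c
  proof -
    have "(\<lambda>k. exp (- (inverse (real (Suc k)) * inverse c))) \<longlonglongrightarrow> exp (- (0 * inverse c))"
      by (intro tendsto_intros LIMSEQ_inverse_real_of_nat)
    moreover have "flat 1 (real (Suc k) * c) = exp (- (inverse (real (Suc k)) * inverse c))" for k
    proof -
      have "real (Suc k) * c > 0" using that by simp
      then show ?thesis by (simp only: flat_def if_True poly_1 inverse_eq_divide) simp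
    qed
    ultimately show ?thesis by simp
  qed
  have "(\<lambda>k. bump (real (Suc k)) A B t) \<longlonglongrightarrow> 1 * 1"
    unfolding bump_def using True by (intro tendsto_mult lim) auto
  then show ?thesis using True by simp
next
  case False
  then have "bump (real (Suc k)) A B t = 0" for k
    by (intro bump_eq_0) auto
  with False show ?thesis by simp
qed

section \<open>Points with equal distances to non-coplanar receivers\<close>

text \<open>Equating the squared distances cancels \<open>|y|\<^sup>2\<close> and leaves one linear equation for \<open>y\<close>. If
  \<open>p \<noteq> q\<close>, its normal vector \<open>2(p - q)\<close> is nonzero, so its solutions form a plane.\<close>

lemma dist_eq_on_noncoplanar:
  fixes p q :: "real ^ 3"
  assumes "\<not> coplanar S" "\<And>y. y \<in> S \<Longrightarrow> norm (y - p) = norm (y - q)"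
  shows "p = q"
proof (rule ccontr)
  assume "p \<noteq> q"
  define H where "H = {y. (2 *\<^sub>R (p - q)) \<bullet> y = p \<bullet> p - q \<bullet> q}"
  have "S \<subseteq> H"
  proof
    fix y assume "y \<in> S"
    then have "(y - p) \<bullet> (y - p) = (y - q) \<bullet> (y - q)"
      using assms(2) by (simp add: dot_square_norm)
    then show "y \<in> H"
      by (simp add: H_def algebra_simps inner_commute)
  qed
  have "aff_dim H = 2"
    unfolding H_def using \<open>p \<noteq> q\<close> by (subst aff_dim_hyperplane) auto
  then have "aff_dim S \<le> 2"
    using aff_dim_subset[OF \<open>S \<subseteq> H\<close>] by simp
  \<comment> \<open>An affine basis of the hull has at most three points, which is what coplanarity asks for.\<close>
  obtain B where B: "\<not> affine_dependent B" "affine hull S = affine hull B"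
    using affine_basis_exists by blast
  then have "int (card B) \<le> 3"
    using aff_dim_unique[of B S] \<open>aff_dim S \<le> 2\<close> by simp
  then have "coplanar B"
    using B by (intro coplanar_small) (auto intro: aff_independent_finite)
  with B assms(1) show False
    by (metis coplanar_affine_hull_coplanar)
qed

section \<open>Arrival and emission times\<close>

text \<open>The arrival time \<open>h(s)\<close>, at a fixed receiver, of a signal emitted at time \<open>s\<close>. A source slower
  than the waves yields a positive derivative for \<open>s > 0\<close>; at \<open>s = 0\<close> only continuity is available.\<close>

locale delay =
  fixes h :: "real \<Rightarrow> real"
  assumes cont: "continuous_on {0..} h"
    and deriv_pos: "\<And>s. s > 0 \<Longrightarrow> \<exists>D>0. (h has_real_derivative D) (at s)"
    and above: "\<And>s. s \<ge> 0 \<Longrightarrow> s < h s"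
begin

lemma less:
  assumes "0 \<le> r" "r < s"
  shows "h r < h s"
proof (rule DERIV_pos_imp_increasing_open[OF \<open>r < s\<close>])
  show "continuous_on {r..s} h"
    by (rule continuous_on_subset[OF cont]) (use assms in auto)
next
  fix z assume "r < z"
  with assms have "z > 0" by simp
  then show "\<exists>D. (h has_real_derivative D) (at z) \<and> D > 0"
    using deriv_pos by blast
qed

lemma less_iff: "0 \<le> r \<Longrightarrow> 0 \<le> s \<Longrightarrow> h r < h s \<longleftrightarrow> r < s"
  using less[of r s] less[of s r] by (cases r s rule: linorder_cases) auto

lemma eq_iff: "0 \<le> r \<Longrightarrow> 0 \<le> s \<Longrightarrow> h r = h s \<longleftrightarrow> r = s"
  using less[of r s] less[of s r] by (cases r s rule: linorder_cases) auto

text \<open>The arrival times are unbounded because no signal arrives before its emission.\<close>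

lemma surj:
  assumes "h 0 \<le> t"
  obtains s where "s \<ge> 0" "h s = t"
proof -
  have "\<exists>s\<ge>0. s \<le> \<bar>t\<bar> \<and> h s = t"
  proof -
    have "t \<le> h \<bar>t\<bar>"
      using above[of "\<bar>t\<bar>"] by simp
    moreover have "continuous_on {0..\<bar>t\<bar>} h"
      by (rule continuous_on_subset[OF cont]) auto
    ultimately show ?thesis
      using IVT'[of h 0 t "\<bar>t\<bar>"] assms by auto
  qed
  then show ?thesis using that by blast
qed

definition emission_time :: "real \<Rightarrow> real" where
  "emission_time t = (THE s. s \<ge> 0 \<and> h s = t)"

lemma emission_time_eq: "s \<ge> 0 \<Longrightarrow> emission_time (h s) = s"
  unfolding emission_time_def using eq_iff by (intro the_equality) auto

lemma emission_time_nonneg: "h 0 \<le> t \<Longrightarrow> emission_time t \<ge> 0"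
  by (rule surj) (auto simp: emission_time_eq)

lemma apply_emission_time: "h 0 \<le> t \<Longrightarrow> h (emission_time t) = t"
  by (rule surj) (auto simp: emission_time_eq)

text \<open>On compact intervals a continuous injection has a continuous inverse, and every arrival time has
  a neighbourhood in \<open>[h(0), \<infinity>)\<close> that is covered by the emission times in some \<open>[0, b]\<close>.\<close>

lemma continuous_emission: "continuous_on {h 0..} emission_time"
proof -
  have "continuous_on {h 0..<h b} emission_time" if "b \<ge> 0" for b
  proof (rule continuous_on_subset)
    show "continuous_on (h ` {0..b}) emission_time"
      by (intro continuous_on_inv continuous_on_subset[OF cont]) (auto simp: emission_time_eq)
    show "{h 0..<h b} \<subseteq> h ` {0..b}"
    proof
      fix t assume t: "t \<in> {h 0..<h b}"
      then obtain s where "s \<ge> 0" "h s = t"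
        using surj by auto
      with t less_iff[of s b] that show "t \<in> h ` {0..b}"
        by auto
    qed
  qed
  show ?thesis
    unfolding continuous_on_eq_continuous_within
  proof
    fix t assume t: "t \<in> {h 0..}"
    define b where "b = emission_time t + 1"
    have b: "b \<ge> 0" "t < h b"
      using t less[of "emission_time t" b] emission_time_nonneg[of t] apply_emission_time[of t] by (auto simp: b_def)
    then have "continuous (at t within {h 0..<h b}) emission_time"
      using \<open>\<And>b. b \<ge> 0 \<Longrightarrow> continuous_on {h 0..<h b} emission_time\<close> t
      by (auto simp: continuous_on_eq_continuous_within)
    moreover have "at t within {h 0..<h b} = at t within {h 0..}"
      by (rule at_within_nhd[where S = "{..<h b}"]) (use b in auto)
    ultimately show "continuous (at t within {h 0..}) emission_time"
      by simp
  qed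
qed

end

section \<open>Comparison of two arrival time functions\<close>

text \<open>The zeros of the cosine are simple: where it vanishes its derivative does not, so it leaves
  \<open>0\<close> with a definite sign.\<close>

lemma cos_sign_right:
  fixes \<omega> \<alpha> :: real
  assumes "\<omega> > 0"
  obtains e \<epsilon> :: real where "\<bar>e\<bar> = 1" "\<epsilon> > 0" "\<And>s. \<alpha> < s \<Longrightarrow> s < \<alpha> + \<epsilon> \<Longrightarrow> e * cos (\<omega> * s) > 0"
proof (cases "cos (\<omega> * \<alpha>) = 0")
  case False
  define e where "e = sgn (cos (\<omega> * \<alpha>))"
  have "isCont (\<lambda>s. e * cos (\<omega> * s)) \<alpha>"
    by (intro continuous_intros)
  moreover have "e * cos (\<omega> * \<alpha>) > 0"
    using False by (simp add: e_def sgn_mult_abs mult_sgn_abs abs_sgn[symmetric] mult.commute)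
  ultimately have "eventually (\<lambda>s. e * cos (\<omega> * s) > 0) (at \<alpha>)"
    unfolding isCont_def by (rule order_tendstoD)
  then obtain d where "d > 0" "\<And>s. s \<noteq> \<alpha> \<Longrightarrow> dist s \<alpha> < d \<Longrightarrow> e * cos (\<omega> * s) > 0"
    unfolding eventually_at by auto
  with that[of e d] False show ?thesis
    by (auto simp: e_def dist_real_def abs_sgn_eq)
next
  case True
  define e where "e = - sin (\<omega> * \<alpha>)"
  have "(sin (\<omega> * \<alpha>))\<^sup>2 = 1"
    using True sin_cos_squared_add[of "\<omega> * \<alpha>"] by simp
  then have "\<bar>e\<bar> = 1"
    by (simp add: e_def power2_eq_1_iff) auto
  have "((\<lambda>s. e * cos (\<omega> * s)) has_real_derivative \<omega> * (sin (\<omega> * \<alpha>))\<^sup>2) (at \<alpha>)"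
    by (auto intro!: derivative_eq_intros simp: e_def power2_eq_square)
  from DERIV_pos_inc_right[OF this] obtain d where "d > 0"
    "\<And>h. h > 0 \<Longrightarrow> h < d \<Longrightarrow> e * cos (\<omega> * \<alpha>) < e * cos (\<omega> * (\<alpha> + h))"
    using assms \<open>(sin (\<omega> * \<alpha>))\<^sup>2 = 1\<close> by auto
  from this(2)[of "s - \<alpha>" for s] True have "\<And>s. \<alpha> < s \<Longrightarrow> s < \<alpha> + d \<Longrightarrow> e * cos (\<omega> * s) > 0"
    by auto
  with that[OF \<open>\<bar>e\<bar> = 1\<close> \<open>d > 0\<close>] show ?thesis .
qed

text \<open>Exchanging the roles of \<open>h\<^sub>1\<close> and \<open>h\<^sub>2\<close> gives the opposite inequality, so one direction is
  enough. With \<open>\<theta> = h\<^sub>2\<^sup>-\<^sup>1 \<circ> h\<^sub>1\<close>, a failure means \<open>\<theta>(s) < s\<close>; going back to the last time \<open>\<alpha>\<close> at which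
  the two arrival times agree, \<open>sin \<omega>s - sin \<omega>\<theta>(s)\<close> would have to move away from its value \<open>0\<close> at
  \<open>\<alpha>\<close> in both directions at once. The argument takes no quotient by \<open>cos(\<omega>\<alpha>)\<close>, so it also passes
  the instants at which the source is silent.\<close>

lemma delay_comparison:
  fixes h\<^sub>1 h\<^sub>2 :: "real \<Rightarrow> real"
  assumes "delay h\<^sub>1" "delay h\<^sub>2" "h\<^sub>1 0 = h\<^sub>2 0" "\<omega> > 0"
    and eq: "\<And>r s. 0 \<le> r \<Longrightarrow> 0 \<le> s \<Longrightarrow> h\<^sub>1 r = h\<^sub>2 s \<Longrightarrow> h\<^sub>1 r < T \<Longrightarrow>
       integral {0..r} (\<lambda>z. cos (\<omega> * z) / (h\<^sub>1 z - z)) =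
       integral {0..s} (\<lambda>z. cos (\<omega> * z) / (h\<^sub>2 z - z))"
    and s: "s \<ge> 0" "h\<^sub>1 s < T"
  shows "h\<^sub>2 s \<le> h\<^sub>1 s"
proof (rule ccontr)
  interpret h1: delay h\<^sub>1 by fact
  interpret h2: delay h\<^sub>2 by fact
  assume "\<not> h\<^sub>2 s \<le> h\<^sub>1 s"
  then have neg: "h\<^sub>1 s < h\<^sub>2 s" by simp
  have cont: "continuous_on {0..s} h\<^sub>1" "continuous_on {0..s} h\<^sub>2"
    by (auto intro: continuous_on_subset[OF h1.cont] continuous_on_subset[OF h2.cont])
  obtain \<alpha> where \<alpha>: "0 \<le> \<alpha>" "\<alpha> < s" "h\<^sub>1 \<alpha> = h\<^sub>2 \<alpha>"
    and after: "\<And>r. \<alpha> < r \<Longrightarrow> r \<le> s \<Longrightarrow> h\<^sub>1 r < h\<^sub>2 r"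
  proof -
    define Z where "Z = {r \<in> {0..s}. h\<^sub>1 r - h\<^sub>2 r = 0}"
    have "closed Z"
      unfolding Z_def by (intro continuous_closed_preimage_constant continuous_on_diff cont) auto
    have "bounded Z"
      unfolding Z_def by (rule bounded_subset[OF bounded_closed_interval[of 0 s]]) auto
    with \<open>closed Z\<close> have "compact Z"
      by (simp add: compact_eq_bounded_closed)
    moreover have "Z \<noteq> {}"
      using assms by (auto simp: Z_def)
    ultimately obtain \<alpha> where \<alpha>: "\<alpha> \<in> Z" "\<And>r. r \<in> Z \<Longrightarrow> r \<le> \<alpha>"
      using compact_attains_sup[of Z] by metis
    show ?thesis
    proof (rule that[of \<alpha>])
      show "0 \<le> \<alpha>" "h\<^sub>1 \<alpha> = h\<^sub>2 \<alpha>" "\<alpha> < s"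
        using \<alpha>(1) neg by (auto simp: Z_def less_le)
    next
      fix r assume r: "\<alpha> < r" "r \<le> s"
      show "h\<^sub>1 r < h\<^sub>2 r"
      proof (rule ccontr)
        assume "\<not> h\<^sub>1 r < h\<^sub>2 r"
        moreover have "continuous_on {r..s} (\<lambda>z. h\<^sub>2 z - h\<^sub>1 z)"
          using r \<alpha>(1)
          by (intro continuous_on_diff continuous_on_subset[OF cont(1)] continuous_on_subset[OF cont(2)])
            (auto simp: Z_def)
        ultimately obtain z where "r \<le> z" "z \<le> s" "h\<^sub>2 z - h\<^sub>1 z = 0"
          using IVT'[of "\<lambda>z. h\<^sub>2 z - h\<^sub>1 z" r 0 s] r neg by auto
        then show False
          using \<alpha>(1) \<alpha>(2)[of z] r by (auto simp: Z_def)
      qed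
    qed
  qed
  obtain e \<epsilon> :: real where e: "\<bar>e\<bar> = 1" "\<epsilon> > 0"
    and sign: "\<And>r. \<alpha> < r \<Longrightarrow> r < \<alpha> + \<epsilon> \<Longrightarrow> e * cos (\<omega> * r) > 0"
    using cos_sign_right[OF \<open>\<omega> > 0\<close>] by blast
  \<comment> \<open>Half of \<open>\<epsilon>\<close>, so that the sign is still known at \<open>b\<close> itself.\<close>
  define b where "b = min s (\<alpha> + \<epsilon> / 2)"
  have b: "\<alpha> < b" "b \<le> s" "b < \<alpha> + \<epsilon>"
    using \<alpha> e by (auto simp: b_def)
  define \<theta> where "\<theta> r = h2.emission_time (h\<^sub>1 r)" for r
  have range: "h\<^sub>2 0 \<le> h\<^sub>1 r" if "r \<ge> 0" for r
    using h1.less[of 0 r] that assms(3) by (cases "r = 0") auto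
  have \<theta>: "\<theta> r \<ge> 0" "h\<^sub>2 (\<theta> r) = h\<^sub>1 r" if "r \<ge> 0" for r
    using h2.emission_time_nonneg h2.apply_emission_time range[OF that] by (auto simp: \<theta>_def)
  have \<theta>_\<alpha>: "\<theta> \<alpha> = \<alpha>"
    using \<alpha> by (simp add: \<theta>_def h2.emission_time_eq)
  have \<theta>_bounds: "\<alpha> < \<theta> r" "\<theta> r < r" if "\<alpha> < r" "r \<le> s" for r
  proof -
    have "h\<^sub>2 (\<theta> r) < h\<^sub>2 r"
      using that \<alpha> \<theta>[of r] after[of r] by simp
    then show "\<theta> r < r"
      using that \<alpha> \<theta>[of r] h2.less_iff[of "\<theta> r" r] by simp
    have "h\<^sub>2 \<alpha> < h\<^sub>2 (\<theta> r)"
      using that \<alpha> \<theta>[of r] h1.less[of \<alpha> r] by simp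
    then show "\<alpha> < \<theta> r"
      using that \<alpha> \<theta>[of r] h2.less_iff[of \<alpha> "\<theta> r"] by simp
  qed
  have \<theta>_cont: "continuous_on {0..s} \<theta>"
    unfolding \<theta>_def using range
    by (intro continuous_on_compose2[OF h2.continuous_emission cont(1)]) auto
  have \<theta>_deriv: "\<exists>D. (\<theta> has_real_derivative D) (at r)" if r: "\<alpha> < r" "r < b" for r
  proof -
    have "0 < r" "r < s" using r b \<alpha> by auto
    obtain D\<^sub>1 where D1: "(h\<^sub>1 has_real_derivative D\<^sub>1) (at r)"
      using h1.deriv_pos \<open>0 < r\<close> by blast
    have "\<theta> r > 0"
      using \<theta>_bounds[of r] r b \<alpha> by simp
    then obtain D\<^sub>2 where D2: "D\<^sub>2 > 0" "(h\<^sub>2 has_real_derivative D\<^sub>2) (at (h2.emission_time (h\<^sub>1 r)))"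
      using h2.deriv_pos unfolding \<theta>_def by blast
    have "h\<^sub>2 0 < h\<^sub>1 r"
      using h1.less[of 0 r] \<open>0 < r\<close> assms(3) by simp
    then have "isCont h2.emission_time (h\<^sub>1 r)"
      by (intro continuous_on_interior[OF h2.continuous_emission]) (simp add: interior_real_atLeast)
    then have "(h2.emission_time has_real_derivative inverse D\<^sub>2) (at (h\<^sub>1 r))"
      using D2 \<open>h\<^sub>2 0 < h\<^sub>1 r\<close> h2.apply_emission_time
      by (intro DERIV_inverse_function[where a = "h\<^sub>2 0" and b = "h\<^sub>1 r + 1"]) auto
    from DERIV_chain2[OF this D1] show ?thesis
      unfolding \<theta>_def by blast
  qed
  define g\<^sub>1 where "g\<^sub>1 z = cos (\<omega> * z) / (h\<^sub>1 z - z)" for z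
  define g\<^sub>2 where "g\<^sub>2 z = cos (\<omega> * z) / (h\<^sub>2 z - z)" for z
  have pos1: "h\<^sub>1 z - z > 0" and pos2: "h\<^sub>2 z - z > 0" if "z \<ge> 0" for z
    using h1.above[OF that] h2.above[OF that] by auto
  have I1: "((\<lambda>z. integral {0..z} g\<^sub>1) has_real_derivative g\<^sub>1 r) (at r)" if "0 < r" for r
  proof -
    have "continuous_on {0..r + 1} g\<^sub>1"
      unfolding g\<^sub>1_def using pos1
      by (intro continuous_intros continuous_on_subset[OF h1.cont]) force+
    from integral_has_real_derivative[OF this, of r] that
    have "((\<lambda>z. integral {0..z} g\<^sub>1) has_real_derivative g\<^sub>1 r) (at r within {0..r + 1})" by simp
    then show ?thesis using that by (simp add: at_within_Icc_at)
  qed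
  have I2: "((\<lambda>z. integral {0..z} g\<^sub>2) has_real_derivative g\<^sub>2 r) (at r)" if "0 < r" for r
  proof -
    have "continuous_on {0..r + 1} g\<^sub>2"
      unfolding g\<^sub>2_def using pos2
      by (intro continuous_intros continuous_on_subset[OF h2.cont]) force+
    from integral_has_real_derivative[OF this, of r] that
    have "((\<lambda>z. integral {0..z} g\<^sub>2) has_real_derivative g\<^sub>2 r) (at r within {0..r + 1})" by simp
    then show ?thesis using that by (simp add: at_within_Icc_at)
  qed
  \<comment> \<open>The factor \<open>e\<close> treats both signs of the cosine at once: \<open>e sin(\<omega>s)\<close> increases after \<open>\<alpha>\<close>.\<close>
  define \<Phi> where "\<Phi> r = e * (sin (\<omega> * r) - sin (\<omega> * \<theta> r))" for r
  have "\<Phi> b < \<Phi> \<alpha>"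
  proof (rule DERIV_neg_imp_decreasing_open[OF b(1)])
    show "continuous_on {\<alpha>..b} \<Phi>"
      unfolding \<Phi>_def using \<alpha> b
      by (intro continuous_intros continuous_on_subset[OF \<theta>_cont]) auto
  next
    fix r assume r: "\<alpha> < r" "r < b"
    then have r': "0 < r" "r < s" using b \<alpha> by auto
    obtain D where D: "(\<theta> has_real_derivative D) (at r)"
      using \<theta>_deriv[OF r] by blast
    have \<theta>r: "\<alpha> < \<theta> r" "\<theta> r < r"
      using \<theta>_bounds[of r] r b by auto
    have int_eq: "integral {0..\<theta> z} g\<^sub>2 = integral {0..z} g\<^sub>1" if "z \<in> {0<..<s}" for z
      using that s \<theta>[of z] h1.less[of z s] unfolding g\<^sub>1_def g\<^sub>2_def
      by (intro eq[symmetric]) auto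
    have "((\<lambda>z. integral {0..\<theta> z} g\<^sub>2) has_real_derivative g\<^sub>2 (\<theta> r) * D) (at r)"
      using DERIV_chain2[OF I2 D] \<theta>r \<alpha> by simp
    then have "((\<lambda>z. integral {0..z} g\<^sub>1) has_real_derivative g\<^sub>2 (\<theta> r) * D) (at r)"
      by (rule has_field_derivative_transform_within_open[where S = "{0<..<s}"])
        (use r' int_eq in auto)
    then have g_eq: "g\<^sub>2 (\<theta> r) * D = g\<^sub>1 r"
      using DERIV_unique I1[OF r'(1)] by blast
    define \<rho> where "\<rho> = h\<^sub>1 r - r"
    have "\<rho> > 0" using pos1[of r] r' by (simp add: \<rho>_def)
    \<comment> \<open>The two signals arrive together, so the one emitted earlier has travelled longer by
      \<open>r - \<theta> r\<close>. This extra attenuation is what produces the sign.\<close>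
    have "h\<^sub>2 (\<theta> r) - \<theta> r = \<rho> + (r - \<theta> r)"
      using \<theta>[of r] r' by (simp add: \<rho>_def)
    then have "cos (\<omega> * \<theta> r) * D / (\<rho> + (r - \<theta> r)) = cos (\<omega> * r) / \<rho>"
      using g_eq by (simp add: g\<^sub>1_def g\<^sub>2_def \<rho>_def)
    then have cos_eq: "cos (\<omega> * \<theta> r) * D = cos (\<omega> * r) * (\<rho> + (r - \<theta> r)) / \<rho>"
      using \<open>\<rho> > 0\<close> \<theta>r by (simp add: field_simps)
    have "(\<Phi> has_real_derivative e * (cos (\<omega> * r) * \<omega> - cos (\<omega> * \<theta> r) * (\<omega> * D))) (at r)"
      unfolding \<Phi>_def by (auto intro!: derivative_eq_intros D)
    also have "e * (cos (\<omega> * r) * \<omega> - cos (\<omega> * \<theta> r) * (\<omega> * D)) =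
        e * \<omega> * (cos (\<omega> * r) - cos (\<omega> * \<theta> r) * D)"
      by (simp add: algebra_simps)
    also have "\<dots> = - (\<omega> * (e * cos (\<omega> * r)) * (r - \<theta> r) / \<rho>)"
      unfolding cos_eq using \<open>\<rho> > 0\<close> by (simp add: field_simps)
    finally show "\<exists>y. (\<Phi> has_real_derivative y) (at r) \<and> y < 0"
      using \<open>\<rho> > 0\<close> \<theta>r sign[of r] r b \<open>\<omega> > 0\<close> by (intro exI conjI) auto
  qed
  moreover have "\<Phi> \<alpha> = 0"
    by (simp add: \<Phi>_def \<theta>_\<alpha>)
  \<comment> \<open>But \<open>\<theta> b < b\<close> both lie in the range where \<open>e sin(\<omega>s)\<close> increases.\<close>
  moreover have "e * sin (\<omega> * \<theta> b) < e * sin (\<omega> * b)"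
  proof (rule DERIV_pos_imp_increasing_open[where f = "\<lambda>z. e * sin (\<omega> * z)"])
    show "\<theta> b < b" using \<theta>_bounds b by auto
    fix r assume "\<theta> b < r" "r < b"
    then have "e * cos (\<omega> * r) > 0"
      using \<theta>_bounds[of b] b by (intro sign) auto
    moreover have "((\<lambda>z. e * sin (\<omega> * z)) has_real_derivative \<omega> * (e * cos (\<omega> * r))) (at r)"
      by (auto intro!: derivative_eq_intros)
    ultimately show "\<exists>y. ((\<lambda>z. e * sin (\<omega> * z)) has_real_derivative y) (at r) \<and> y > 0"
      using mult_pos_pos[OF \<open>\<omega> > 0\<close>] by blast
  qed (intro continuous_intros)
  ultimately show False
    unfolding \<Phi>_def right_diff_distrib \<theta>_\<alpha> by linarith
qed

section \<open>The field of a moving source\<close>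

lemma orbit_speed:
  assumes "orbit_function R\<^sub>1 a" "s > 0"
  obtains v where "(a has_vector_derivative v) (at s)" "norm v < 1"
proof -
  have "C2_on a {0<..}" and speed: "norm (vector_derivative a (at s)) < 1"
    using assms by (simp_all add: orbit_function_def)
  then obtain a' where "\<forall>t\<in>{0<..}. (a has_vector_derivative a' t) (at t)"
    unfolding C2_on_def by metis
  then have v: "(a has_vector_derivative a' s) (at s)"
    using \<open>s > 0\<close> by simp
  show ?thesis
    using that[OF v] speed vector_derivative_at[OF v] by simp
qed

lemma orbit_distance:
  assumes "orbit_function R\<^sub>1 a" "R\<^sub>1 > 0" "y \<in> sphere 0 R" "s \<ge> 0"
  shows "R - R\<^sub>1 \<le> norm (y - a s)" "norm (y - a s) \<le> R + R\<^sub>1"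
proof -
  have "norm (a s) \<le> R\<^sub>1"
    using assms by (cases "s = 0") (auto simp: orbit_function_def intro: less_imp_le)
  moreover have "norm y = R"
    using assms by simp
  ultimately show "R - R\<^sub>1 \<le> norm (y - a s)" "norm (y - a s) \<le> R + R\<^sub>1"
    using norm_triangle_ineq2[of y "a s"] norm_triangle_ineq4[of y "a s"] by auto
qed

text \<open>The distance to the receiver changes at most at the speed of the source, which is less than
  \<open>1\<close>. It is at least \<open>R - R\<^sub>1 > 0\<close>, so the norm is differentiable along the orbit.\<close>

lemma delay_orbit:
  assumes a: "orbit_function R\<^sub>1 a" and "0 < R\<^sub>1" "R\<^sub>1 < R" "y \<in> sphere 0 R"
  shows "delay (\<lambda>s. s + norm (y - a s))"
proof
  note dist = orbit_distance[OF a \<open>0 < R\<^sub>1\<close> \<open>y \<in> sphere 0 R\<close>]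
  show "continuous_on {0..} (\<lambda>s. s + norm (y - a s))"
    using a by (intro continuous_intros) (auto simp: orbit_function_def)
  show "s < s + norm (y - a s)" if "s \<ge> 0" for s
    using dist(1)[OF that] \<open>R\<^sub>1 < R\<close> by linarith
  show "\<exists>D>0. ((\<lambda>s. s + norm (y - a s)) has_real_derivative D) (at s)" if "s > 0" for s
  proof -
    obtain v where v: "(a has_vector_derivative v) (at s)" "norm v < 1"
      using orbit_speed[OF a \<open>s > 0\<close>] by blast
    have "norm (y - a s) > 0"
      using dist(1)[of s] that assms by linarith
    then have "y - a s \<noteq> 0"
      by simp
    define n where "n = sgn (y - a s)"
    have "norm n = 1"
      using \<open>y - a s \<noteq> 0\<close> by (simp add: n_def norm_sgn)
    have "((\<lambda>s. y - a s) has_derivative (\<lambda>h. - (h *\<^sub>R v))) (at s)"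
      using v(1) unfolding has_vector_derivative_def by (auto intro!: derivative_eq_intros)
    then have "((\<lambda>s. norm (y - a s)) has_derivative (\<lambda>h. (- (h *\<^sub>R v)) \<bullet> n)) (at s)"
      using has_derivative_norm[OF \<open>y - a s \<noteq> 0\<close>]
      unfolding n_def by (rule has_derivative_compose)
    then have "((\<lambda>s. norm (y - a s)) has_real_derivative - (v \<bullet> n)) (at s)"
      unfolding has_field_derivative_def
      by (rule has_derivative_eq_rhs) (simp add: fun_eq_iff)
    then have "((\<lambda>s. s + norm (y - a s)) has_real_derivative 1 - v \<bullet> n) (at s)"
      by (auto intro!: derivative_eq_intros)
    moreover have "v \<bullet> n < 1"
      using norm_cauchy_schwarz[of v n] \<open>norm n = 1\<close> v(2) by simp
    ultimately show ?thesis
      by (intro exI[of _ "1 - v \<bullet> n"]) auto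
  qed
qed

text \<open>The bumps on \<open>(A, h(s))\<close> converge to the indicator of that interval, and \<open>A < R = h(0)\<close> lies before
  the first arrival, so in the limit exactly the emission times in \<open>[0, s)\<close> contribute. Dominated
  convergence applies because signals emitted after \<open>s\<close> do not meet the support and \<open>R - R\<^sub>1\<close>
  bounds the distance to the source from below.\<close>

lemma wave_field_bump_tendsto:
  assumes a: "orbit_function R\<^sub>1 a" and "0 < R\<^sub>1" "R\<^sub>1 < R" "y \<in> sphere 0 R"
    and "A < R" "s \<ge> 0"
  defines "h \<equiv> \<lambda>z. z + norm (y - a z)"
  shows "(\<lambda>k. wave_field \<omega> a y (bump (real (Suc k)) A (h s)))
    \<longlonglongrightarrow> integral {0..s} (\<lambda>z. cos (\<omega> * z) / (h z - z)) / (4 * pi)"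
proof -
  interpret h: delay h
    unfolding h_def by (rule delay_orbit) fact+
  note dist = orbit_distance[OF a \<open>0 < R\<^sub>1\<close> \<open>y \<in> sphere 0 R\<close>]
  define g where "g z = 1 / (4 * pi * norm (y - a z)) * cos (\<omega> * z)" for z
  have cont_a: "continuous_on {0..} a" and "a 0 = 0"
    using a by (auto simp: orbit_function_def)
  have dist_pos: "norm (y - a z) > 0" if "z \<ge> 0" for z
    using dist(1)[OF that] \<open>R\<^sub>1 < R\<close> by linarith
  have g_cont: "continuous_on {0..} g"
    unfolding g_def using dist_pos by (intro continuous_intros cont_a) force
  have g_bound: "\<bar>g z\<bar> \<le> 1 / (4 * pi * (R - R\<^sub>1))" if "z \<ge> 0" for z
  proof -
    have "\<bar>g z\<bar> \<le> 1 / (4 * pi * norm (y - a z)) * 1"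
      unfolding g_def abs_mult using dist_pos[OF that] by (intro mult_mono) auto
    also have "\<dots> \<le> 1 / (4 * pi * (R - R\<^sub>1))"
      using dist(1)[OF that] assms by (simp add: frac_le)
    finally show ?thesis .
  qed
  have meas: "(\<lambda>z. indicator S z *\<^sub>R f z) \<in> borel_measurable lborel"
    if "continuous_on {0..} f" "S \<subseteq> {0..}" "S \<in> sets borel" for f :: "real \<Rightarrow> real" and S
    using borel_measurable_continuous_on_indicator[OF _ continuous_on_subset[OF that(1,2)]] that(3)
    by simp
  define \<phi> where "\<phi> k z = bump (real (Suc k)) A (h s) (h z)" for k z
  have \<phi>_cont: "continuous_on {0..} (\<phi> k)" for k
  proof -
    have "bump (real (Suc k)) A (h s) differentiable (at t)" for t
      using test_function_bump[of "real (Suc k)" A "h s" UNIV]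
      by (auto simp: test_function_def dest: spec[of _ 0])
    then have "continuous_on UNIV (bump (real (Suc k)) A (h s))"
      by (meson differentiable_at_imp_differentiable_on differentiable_imp_continuous_on)
    then show ?thesis
      unfolding \<phi>_def by (rule continuous_on_compose2[OF _ h.cont]) auto
  qed
  have "(\<lambda>k. LBINT z. indicator {0..} z *\<^sub>R (\<phi> k z * g z))
      \<longlonglongrightarrow> (LBINT z. indicator {0..<s} z *\<^sub>R g z)"
  proof (rule integral_dominated_convergence[where
        w = "\<lambda>z. indicator {0..s} z *\<^sub>R (1 / (4 * pi * (R - R\<^sub>1)))"])
    show "(\<lambda>z. indicator {0..<s} z *\<^sub>R g z) \<in> borel_measurable lborel"
      by (rule meas[OF g_cont]) auto
    show "(\<lambda>z. indicator {0..} z *\<^sub>R (\<phi> k z * g z)) \<in> borel_measurable lborel" for k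
      by (rule meas[OF continuous_on_mult[OF \<phi>_cont g_cont]]) auto
    show "integrable lborel (\<lambda>z. indicator {0..s} z *\<^sub>R (1 / (4 * pi * (R - R\<^sub>1))))"
      using \<open>s \<ge> 0\<close> by (intro integrable_scaleR_left integrable_real_indicator) auto
    show "AE z in lborel. norm (indicator {0..} z *\<^sub>R (\<phi> k z * g z))
        \<le> indicator {0..s} z *\<^sub>R (1 / (4 * pi * (R - R\<^sub>1)))" for k
    proof (rule AE_I2)
      fix z :: real
      show "norm (indicator {0..} z *\<^sub>R (\<phi> k z * g z)) \<le> indicator {0..s} z *\<^sub>R (1 / (4 * pi * (R - R\<^sub>1)))"
      proof (cases "0 \<le> z")
        case True
        show ?thesis
        proof (cases "z \<le> s")
          case True
          have "\<bar>\<phi> k z\<bar> * \<bar>g z\<bar> \<le> 1 * (1 / (4 * pi * (R - R\<^sub>1)))"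
            using g_bound[OF \<open>0 \<le> z\<close>] bump_range by (intro mult_mono) (auto simp: \<phi>_def)
          with True \<open>0 \<le> z\<close> show ?thesis by (simp add: abs_mult)
        next
          case False
          then have "\<phi> k z = 0"
            unfolding \<phi>_def using h.less[of s z] \<open>s \<ge> 0\<close> by (intro bump_eq_0) auto
          with False show ?thesis by simp
        qed
      qed simp
    qed
    show "AE z in lborel. (\<lambda>k. indicator {0..} z *\<^sub>R (\<phi> k z * g z)) \<longlonglongrightarrow> indicator {0..<s} z *\<^sub>R g z"
    proof (rule AE_I2)
      fix z :: real
      show "(\<lambda>k. indicator {0..} z *\<^sub>R (\<phi> k z * g z)) \<longlonglongrightarrow> indicator {0..<s} z *\<^sub>R g z"
      proof (cases "0 \<le> z")
        case True
        have "h 0 = R" using assms \<open>a 0 = 0\<close> by (simp add: h_def)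
        then have "A < h z"
          using h.less[of 0 z] True \<open>A < R\<close> by (cases "z = 0") auto
        then have "indicator {A<..<h s} (h z) = (indicator {0..<s} z :: real)"
          using True \<open>s \<ge> 0\<close> h.less_iff[of z s] by (auto simp: indicator_def)
        moreover have "(\<lambda>k. \<phi> k z * g z) \<longlonglongrightarrow> indicator {A<..<h s} (h z) * g z"
          unfolding \<phi>_def by (intro tendsto_intros bump_tendsto_indicator)
        ultimately show ?thesis using True by simp
      qed simp
    qed
  qed
  moreover have "(LBINT z. indicator {0..} z *\<^sub>R (\<phi> k z * g z))
      = wave_field \<omega> a y (bump (real (Suc k)) A (h s))" for k
    unfolding wave_field_def set_lebesgue_integral_def dirac_def \<phi>_def g_def h_def
    by (simp add: mult.assoc)
  moreover have "(LBINT z. indicator {0..<s} z *\<^sub>R g z)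
      = integral {0..s} (\<lambda>z. cos (\<omega> * z) / (h z - z)) / (4 * pi)"
  proof -
    have "(LBINT z. indicator {0..<s} z *\<^sub>R g z) = (LBINT z:{0..s}. g z)"
      unfolding set_lebesgue_integral_def
    proof (rule integral_cong_AE)
      show "AE z in lborel. indicator {0..<s} z *\<^sub>R g z = indicator {0..s} z *\<^sub>R g z"
        using AE_lborel_singleton[of s] by eventually_elim (auto simp: indicator_def)
      show "(\<lambda>z. indicator {0..<s} z *\<^sub>R g z) \<in> borel_measurable lborel"
           "(\<lambda>z. indicator {0..s} z *\<^sub>R g z) \<in> borel_measurable lborel"
        by (rule meas[OF g_cont]; auto)+
    qed
    also have "\<dots> = integral {0..s} g"
      by (intro set_borel_integral_eq_integral borel_integrable_atLeastAtMost'
          continuous_on_subset[OF g_cont]) auto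
    also have "\<dots> = integral {0..s} (\<lambda>z. (1 / (4 * pi)) * (cos (\<omega> * z) / (h z - z)))"
      by (intro integral_cong) (simp add: g_def h_def)
    also have "\<dots> = integral {0..s} (\<lambda>z. cos (\<omega> * z) / (h z - z)) / (4 * pi)"
      by (subst integral_mult_right) simp
    finally show ?thesis .
  qed
  ultimately show ?thesis by simp
qed

text \<open>The denominators \<open>(z + |y - a(z)|) - z\<close> are arrival minus emission time, in the form in which
  \<open>delay_comparison\<close> uses them.\<close>

lemma emission_integral_eq:
  assumes orbit: "orbit_function R\<^sub>1 a\<^sub>1" "orbit_function R\<^sub>1 a\<^sub>2"
    and R: "0 < R\<^sub>1" "R\<^sub>1 < R" "y \<in> sphere 0 R"
    and data: "distr_eq_on {0<..<T} (wave_field \<omega> a\<^sub>1 y) (wave_field \<omega> a\<^sub>2 y)"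
    and rs: "0 \<le> r" "0 \<le> s"
    and eq: "r + norm (y - a\<^sub>1 r) = s + norm (y - a\<^sub>2 s)" "r + norm (y - a\<^sub>1 r) < T"
  shows "integral {0..r} (\<lambda>z. cos (\<omega> * z) / ((z + norm (y - a\<^sub>1 z)) - z))
       = integral {0..s} (\<lambda>z. cos (\<omega> * z) / ((z + norm (y - a\<^sub>2 z)) - z))"
proof -
  define B where "B = r + norm (y - a\<^sub>1 r)"
  \<comment> \<open>Any left end in \<open>(0, R)\<close> would do: positive, so that the support lies in \<open>(0, T)\<close>, and before the
    first arrival at time \<open>R\<close>.\<close>
  have "wave_field \<omega> a\<^sub>1 y (bump (real (Suc k)) (R / 2) B) =
        wave_field \<omega> a\<^sub>2 y (bump (real (Suc k)) (R / 2) B)" for k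
    using data test_function_bump[of "real (Suc k)" "R / 2" B "{0<..<T}"] R eq(2)
    by (force simp: distr_eq_on_def B_def)
  moreover have "(\<lambda>k. wave_field \<omega> a\<^sub>1 y (bump (real (Suc k)) (R / 2) B))
      \<longlonglongrightarrow> integral {0..r} (\<lambda>z. cos (\<omega> * z) / ((z + norm (y - a\<^sub>1 z)) - z)) / (4 * pi)"
    unfolding B_def by (rule wave_field_bump_tendsto[OF orbit(1) R]) (use R rs in auto)
  moreover have "(\<lambda>k. wave_field \<omega> a\<^sub>2 y (bump (real (Suc k)) (R / 2) B))
      \<longlonglongrightarrow> integral {0..s} (\<lambda>z. cos (\<omega> * z) / ((z + norm (y - a\<^sub>2 z)) - z)) / (4 * pi)"
    unfolding B_def eq(1) by (rule wave_field_bump_tendsto[OF orbit(2) R]) (use R rs in auto)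
  ultimately show ?thesis
    using LIMSEQ_unique by fastforce
qed

section \<open>Uniqueness of the orbit\<close>

theorem theorem3p1:
  fixes R\<^sub>1 R \<omega> T\<^sub>0 T :: real
    and x :: "nat \<Rightarrow> real ^ 3"
    and a\<^sub>1 a\<^sub>2 :: "real \<Rightarrow> real ^ 3"
  assumes "0 < R\<^sub>1" "R\<^sub>1 < R" "\<omega> > 0" "T\<^sub>0 > 0" "T > R + R\<^sub>1 + T\<^sub>0"
    and "\<And>j. j \<in> {1..4} \<Longrightarrow> x j \<in> sphere 0 R"
    and "\<not> coplanar (x ` {1..4})"
    and "orbit_function R\<^sub>1 a\<^sub>1" "orbit_function R\<^sub>1 a\<^sub>2"
    and "\<And>j. j \<in> {1..4} \<Longrightarrow> distr_eq_on {0<..<T} (wave_field \<omega> a\<^sub>1 (x j)) (wave_field \<omega> a\<^sub>2 (x j))"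
  shows "\<forall>t\<in>{0<..<T\<^sub>0}. a\<^sub>1 t = a\<^sub>2 t"
proof
  fix t assume t: "t \<in> {0<..<T\<^sub>0}"
  have le: "norm (y - b\<^sub>2 t) \<le> norm (y - b\<^sub>1 t)"
    if "orbit_function R\<^sub>1 b\<^sub>1" "orbit_function R\<^sub>1 b\<^sub>2" "y \<in> sphere 0 R"
      "distr_eq_on {0<..<T} (wave_field \<omega> b\<^sub>1 y) (wave_field \<omega> b\<^sub>2 y)" for b\<^sub>1 b\<^sub>2 y
  proof -
    note R = \<open>0 < R\<^sub>1\<close> \<open>R\<^sub>1 < R\<close> that(3)
    have "t + norm (y - b\<^sub>2 t) \<le> t + norm (y - b\<^sub>1 t)"
    proof (rule delay_comparison[where h\<^sub>1 = "\<lambda>s. s + norm (y - b\<^sub>1 s)"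
          and h\<^sub>2 = "\<lambda>s. s + norm (y - b\<^sub>2 s)" and \<omega> = \<omega> and T = T])
      show "delay (\<lambda>s. s + norm (y - b\<^sub>1 s))" "delay (\<lambda>s. s + norm (y - b\<^sub>2 s))"
        by (fact delay_orbit[OF that(1) R] delay_orbit[OF that(2) R])+
      show "0 + norm (y - b\<^sub>1 0) = 0 + norm (y - b\<^sub>2 0)"
        using that(1,2) by (simp add: orbit_function_def)
      show "t + norm (y - b\<^sub>1 t) < T"
        using orbit_distance(2)[OF that(1) \<open>0 < R\<^sub>1\<close> that(3), of t] t assms by simp
    qed (use emission_integral_eq[OF that(1,2) R that(4)] \<open>\<omega> > 0\<close> t in simp_all)
    then show ?thesis by simp
  qed
  have "norm (y - a\<^sub>1 t) = norm (y - a\<^sub>2 t)" if y: "y \<in> x ` {1..4}" for y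
  proof (rule antisym)
    have "y \<in> sphere 0 R"
      and data: "distr_eq_on {0<..<T} (wave_field \<omega> a\<^sub>1 y) (wave_field \<omega> a\<^sub>2 y)"
      using y assms by auto
    then show "norm (y - a\<^sub>2 t) \<le> norm (y - a\<^sub>1 t)"
      using le assms by blast
    have "distr_eq_on {0<..<T} (wave_field \<omega> a\<^sub>2 y) (wave_field \<omega> a\<^sub>1 y)"
      using data by (simp add: distr_eq_on_def)
    then show "norm (y - a\<^sub>1 t) \<le> norm (y - a\<^sub>2 t)"
      using le assms \<open>y \<in> sphere 0 R\<close> by blast
  qed
  then show "a\<^sub>1 t = a\<^sub>2 t"
    using dist_eq_on_noncoplanar[OF \<open>\<not> coplanar (x ` {1..4})\<close>] by blast
qed

end
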